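(* Let $m>2$ and $k$ be integers with $0<k<2^m$, and let $N=k\cdot 2^m+1$. Suppose that one of the following holds: $k \equiv 1 \pmod{42}$ and $m \equiv 2,4 \pmod{6}$; $k \equiv 5 \pmod{42}$ and $m \equiv 3 \pmod{6}$; $k \equiv 11 \pmod{42}$ and $m \equiv 3,5 \pmod{6}$; $k \equiv 13 \pmod{42}$ and $m \equiv 4 \pmod{6}$; $k \equiv 17 \pmod{42}$ and $m \equiv 5 \pmod{6}$; $k \equiv 19 \pmod{42}$ and $m \equiv 0 \pmod{6}$; $k \equiv 23 \pmod{42}$ and $m \equiv 1,3 \pmod{6}$; $k \equiv 25 \pmod{42}$ and $m \equiv 0,2 \pmod{6}$; $k \equiv 29 \pmod{42}$ and $m \equiv 1,5 \pmod{6}$; $k \equiv 31 \pmod{42}$ and $m \equiv 2 \pmod{6}$; $k \equiv 37 \pmod{42}$ and $m \equiv 0,4 \pmod{6}$; $k \equiv 41 \pmod{42}$ and $m \equiv 1 \pmod{6}$. Let $x=V_k(5,1)$. Then $N$ is prime if and only if $N \mid S_{m-2}(x)$.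
   Context: For $P,Q\in\mathbb{Z}$ the Lucas sequence $\{V_n(P,Q)\}$ is defined by $V_0(P,Q)=2$, $V_1(P,Q)=P$, $V_{n+1}(P,Q)=PV_n(P,Q)-QV_{n-1}(P,Q)$ for $n\ge 1$. For an integer $x$, the sequence $S_n(x)$ is defined by $S_0(x)=x$ and $S_{j+1}(x)=(S_j(x))^2-2$ for $j\ge 0$. *)

theory Defs
  imports "HOL-Number_Theory.Number_Theory"
begin

fun lucas_V :: "int \<Rightarrow> int \<Rightarrow> nat \<Rightarrow> int" where
  "lucas_V P Q 0 = 2"
| "lucas_V P Q (Suc 0) = P"
| "lucas_V P Q (Suc (Suc n)) = P * lucas_V P Q (Suc n) - Q * lucas_V P Q n"

primrec S :: "nat \<Rightarrow> int \<Rightarrow> int" where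
  "S 0 x = x"
| "S (Suc j) x = (S j x)\<^sup>2 - 2"

end

theory Submission
  imports Defs
begin

text \<open>
  Write \<open>V n\<close> for \<open>lucas_V 5 1 n\<close>. Since \<open>V (2 * n) = (V n)\<^sup>2 - 2\<close>, the number \<open>S (m - 2) x\<close> is
  \<open>V (k * 2 ^ (m - 2))\<close>.

  Let \<open>N\<close> be prime. The congruence conditions give \<open>N \<equiv> 2 (mod 3)\<close> and
  \<open>N \<equiv> 3, 5, 6 (mod 7)\<close>, so by reciprocity \<open>3\<close> and \<open>7\<close> are non-residues modulo \<open>N\<close> and
  \<open>21 \<equiv> s\<^sup>2\<close> for some \<open>s\<close>. With \<open>A = 5 + s\<close> and \<open>B = 5 - s\<close> we have \<open>2 ^ n * V n \<equiv> A ^ n + B ^ n\<close>,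
  \<open>A * B \<equiv> 4\<close> and \<open>6 * A \<equiv> (3 + s)\<^sup>2\<close>. The last relation determines \<open>A ^ ((N - 1) / 2)\<close>
  and forces \<open>V ((N - 1) / 4) \<equiv> 0\<close>.

  Conversely, let \<open>p\<close> be a prime divisor of \<open>N\<close> with \<open>p\<^sup>2 \<le> N\<close>. From \<open>V p \<equiv> V 1 (mod p)\<close> one gets
  \<open>(V (p + 1) - 2) * (V (p + 1) - V 2) \<equiv> 0\<close>, and hence \<open>V (p + 1) \<equiv> 2\<close> or \<open>V (p - 1) \<equiv> 2\<close>,
  with no case distinction on the quadratic character of \<open>21\<close>. As
  \<open>V (k * 2 ^ (m - 1)) \<equiv> -2\<close>, the composition law \<open>V (n * j) = lucas_V (V n) 1 j\<close> gives
  \<open>2 ^ m dvd p + 1\<close> or \<open>2 ^ m dvd p - 1\<close>, which leaves only \<open>p = 2 ^ m - 1\<close>; but that would force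
  \<open>k = 2 ^ m - 2\<close>, whereas \<open>k\<close> is odd.
\<close>

subsection \<open>Lucas sequences with \<open>Q = 1\<close>\<close>

text \<open>For \<open>Q = 1\<close> the recurrence, run backwards, extends the sequence evenly to negative indices.\<close>

definition lucas_int :: "int \<Rightarrow> int \<Rightarrow> int" where
  "lucas_int P i = lucas_V P 1 (nat \<bar>i\<bar>)"

lemma lucas_int_of_nat [simp]: "lucas_int P (int n) = lucas_V P 1 n"
  by (simp add: lucas_int_def)

lemma lucas_int_minus: "lucas_int P (- i) = lucas_int P i"
  by (simp add: lucas_int_def)

lemma lucas_int_rec: "lucas_int P (i + 1) + lucas_int P (i - 1) = P * lucas_int P i"
proof -
  have pos: "lucas_int P (int n + 1) + lucas_int P (int n - 1) = P * lucas_int P (int n)" for n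
  proof (cases n)
    case 0
    then show ?thesis by (simp add: lucas_int_def)
  next
    case (Suc l)
    then have "nat \<bar>int n + 1\<bar> = Suc (Suc l)" "nat \<bar>int n - 1\<bar> = l" by auto
    then show ?thesis using Suc by (simp add: lucas_int_def del: of_nat_Suc)
  qed
  show ?thesis
  proof (cases "i \<ge> 0")
    case True
    then show ?thesis using pos[of "nat i"] by simp
  next
    case False
    then have "int (nat (- i)) = - i" by simp
    then have "lucas_int P (- i + 1) + lucas_int P (- i - 1) = P * lucas_int P (- i)"
      using pos[of "nat (- i)"] by simp
    moreover have "lucas_int P (- i + 1) = lucas_int P (i - 1)"
      "lucas_int P (- i - 1) = lucas_int P (i + 1)"
      using lucas_int_minus[of P "i - 1"] lucas_int_minus[of P "- i - 1"] by (simp_all add: algebra_simps)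
    ultimately show ?thesis by (simp add: lucas_int_minus)
  qed
qed

text \<open>As functions of \<open>n\<close> both sides satisfy the same recurrence and agree at
  \<open>0\<close> and \<open>1\<close>. The signed index lets \<open>i - n\<close> drop below
  zero.\<close>

lemma lucas_int_add_diff:
  "lucas_int P (i + int n) + lucas_int P (i - int n) = lucas_int P i * lucas_V P 1 n"
proof (induction n rule: induct_nat_012)
  case 0
  then show ?case by simp
next
  case 1
  then show ?case using lucas_int_rec[of P i] by simp
next
  case (ge2 n)
  have "lucas_int P (i + int (Suc (Suc n))) = P * lucas_int P (i + int (Suc n)) - lucas_int P (i + int n)"
    using lucas_int_rec[of P "i + int (Suc n)"] by (simp add: algebra_simps)
  moreover have "lucas_int P (i - int (Suc (Suc n))) = P * lucas_int P (i - int (Suc n)) - lucas_int P (i - int n)"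
    using lucas_int_rec[of P "i - int (Suc n)"] by (simp add: algebra_simps)
  ultimately have "lucas_int P (i + int (Suc (Suc n))) + lucas_int P (i - int (Suc (Suc n)))
      = P * (lucas_int P (i + int (Suc n)) + lucas_int P (i - int (Suc n)))
        - (lucas_int P (i + int n) + lucas_int P (i - int n))"
    by (simp only:) (simp only: algebra_simps)
  then show ?case unfolding ge2 by (simp add: algebra_simps)
qed

lemma lucas_V_add_diff:
  assumes "n \<le> l"
  shows "lucas_V P 1 (l + n) + lucas_V P 1 (l - n) = lucas_V P 1 l * lucas_V P 1 n"
  using lucas_int_add_diff[of P "int l" n] assms
  by (simp add: lucas_int_of_nat[symmetric] del: lucas_int_of_nat)

lemma lucas_V_double: "lucas_V P 1 (2 * n) = (lucas_V P 1 n)\<^sup>2 - 2"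
  using lucas_V_add_diff[of n n P] by (simp add: power2_eq_square mult_2)

text \<open>By \<open>lucas_V_add_diff\<close> with step \<open>n\<close>, the values at
  \<open>n * j\<close> obey, in \<open>j\<close>, the recurrence with parameter
  \<open>lucas_V P 1 n\<close>.\<close>

lemma lucas_V_mult: "lucas_V P 1 (n * j) = lucas_V (lucas_V P 1 n) 1 j"
proof (induction j rule: induct_nat_012)
  case (ge2 j)
  have "lucas_V P 1 (n * Suc j + n) + lucas_V P 1 (n * Suc j - n) = lucas_V P 1 (n * Suc j) * lucas_V P 1 n"
    by (rule lucas_V_add_diff) simp
  then show ?case using ge2 by (simp add: algebra_simps)
qed simp_all

lemma S_lucas_V: "S j (lucas_V P 1 n) = lucas_V P 1 (n * 2 ^ j)"
proof (induction j)
  case (Suc j)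
  then show ?case using lucas_V_double[of P "n * 2 ^ j"] by (simp add: mult_ac)
qed simp

lemma lucas_V_cong:
  assumes "[P = P'] (mod p)"
  shows "[lucas_V P Q n = lucas_V P' Q n] (mod p)"
  by (induction n rule: induct_nat_012) (auto intro!: cong_diff cong_mult assms)

lemma lucas_V_2: "lucas_V 2 1 n = 2"
  by (induction n rule: induct_nat_012) auto

lemma lucas_V_minus_2: "lucas_V (- 2) 1 n = 2 * (- 1) ^ n"
  by (induction n rule: induct_nat_012) auto

subsection \<open>Divisibility by a prime\<close>

text \<open>
  This is the binomial expansion of \<open>(\<alpha> + 1 / \<alpha>) ^ n\<close> for a root \<open>\<alpha>\<close> of \<open>X\<^sup>2 - P * X + 1\<close>, in a form that
  stays within the integers.
\<close>

lemma sum_choose_lucas_int: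
  "(\<Sum>j\<le>n. int (n choose j) * lucas_int P (i + int n - 2 * int j)) = P ^ n * lucas_int P i"
proof (induction n arbitrary: i)
  case (Suc n)
  let ?f = "\<lambda>j. lucas_int P (i + int (Suc n) - 2 * int j)"
  have "(\<Sum>j\<le>Suc n. int (Suc n choose j) * ?f j)
      = ?f 0 + (\<Sum>j\<le>n. int (Suc n choose Suc j) * ?f (Suc j))"
    by (subst sum.atMost_Suc_shift) simp
  also have "(\<Sum>j\<le>n. int (Suc n choose Suc j) * ?f (Suc j))
      = (\<Sum>j\<le>n. int (n choose j) * ?f (Suc j)) + (\<Sum>j\<le>n. int (n choose Suc j) * ?f (Suc j))"
    by (simp add: sum.distrib[symmetric] distrib_right)
  also have "?f 0 + (\<dots>) = (\<Sum>j\<le>n. int (n choose j) * ?f (Suc j)) + (\<Sum>j\<le>Suc n. int (n choose j) * ?f j)"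
    by (simp only: sum.atMost_Suc_shift[of _ n]) simp
  also have "(\<Sum>j\<le>Suc n. int (n choose j) * ?f j) = (\<Sum>j\<le>n. int (n choose j) * ?f j)"
    by simp
  also have "(\<Sum>j\<le>n. int (n choose j) * ?f (Suc j)) = P ^ n * lucas_int P (i - 1)"
    using Suc[of "i - 1"] by (simp add: algebra_simps)
  also have "(\<Sum>j\<le>n. int (n choose j) * ?f j) = P ^ n * lucas_int P (i + 1)"
    using Suc[of "i + 1"] by (simp add: algebra_simps)
  also have "P ^ n * lucas_int P (i - 1) + P ^ n * lucas_int P (i + 1) = P ^ Suc n * lucas_int P i"
    using lucas_int_rec[of P i] by (simp add: distrib_left[symmetric] add.commute)
  finally show ?case .
qed simp

lemma fermat_int:
  fixes a :: int
  assumes "prime p" and "\<not> int p dvd a"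
  shows "[a ^ (p - 1) = 1] (mod int p)"
proof -
  have p: "p > 0" using assms(1) prime_gt_0_nat by blast
  define b where "b = nat (a mod int p)"
  have b: "[int b = a] (mod int p)"
    using p by (simp add: b_def cong_def)
  then have "\<not> p dvd b"
    using assms(2) int_dvd_int_iff by (metis cong_0_iff cong_sym cong_trans)
  then have "[b ^ (p - 1) = 1] (mod p)" using assms(1) fermat_theorem by blast
  then have "[int b ^ (p - 1) = 1] (mod int p)"
    by (metis cong_int_iff of_nat_1 of_nat_power)
  then show ?thesis using b by (meson cong_pow cong_sym cong_trans)
qed

text \<open>In the expansion at \<open>i = 0\<close> the inner binomial coefficients vanish modulo
  \<open>p\<close> and both end terms are \<open>lucas_V P 1 p\<close> by evenness; Fermat's theorem
  then replaces \<open>P ^ p\<close> by \<open>P\<close>.\<close>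

lemma lucas_V_prime:
  assumes "prime p" and "odd p"
  shows "[lucas_V P 1 p = P] (mod int p)"
proof -
  let ?f = "\<lambda>j. int (p choose j) * lucas_int P (int p - 2 * int j)"
  have p: "p > 0" using assms(1) prime_gt_0_nat by blast
  have "2 * P ^ p = (\<Sum>j\<le>p. ?f j)"
    using sum_choose_lucas_int[of p P 0] by (simp add: lucas_int_def)
  also have "{..p} = insert 0 (insert p {0<..<p})" using p by auto
  also have "(\<Sum>j\<in>\<dots>. ?f j) = 2 * lucas_V P 1 p + (\<Sum>j\<in>{0<..<p}. ?f j)"
    using p lucas_int_minus[of P "int p"] by simp
  finally have eq: "2 * P ^ p = 2 * lucas_V P 1 p + (\<Sum>j\<in>{0<..<p}. ?f j)" .
  have "int p dvd (\<Sum>j\<in>{0<..<p}. ?f j)"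
    using assms(1) by (intro dvd_sum dvd_mult2) (auto intro!: dvd_choose_prime)
  then have "[2 * P ^ p = 2 * lucas_V P 1 p] (mod int p)"
    unfolding eq by (simp add: cong_iff_dvd_diff)
  moreover have "coprime 2 (int p)" using assms(2) by simp
  ultimately have "[P ^ p = lucas_V P 1 p] (mod int p)"
    using cong_mult_lcancel by blast
  moreover have "[P ^ p = P] (mod int p)"
  proof (cases "int p dvd P")
    case True
    then show ?thesis using p by (meson cong_0_iff cong_sym cong_trans dvd_power dvd_trans)
  next
    case False
    then have "[P * P ^ (p - 1) = P * 1] (mod int p)"
      using fermat_int[OF assms(1)] cong_scalar_left by blast
    then show ?thesis using p by (simp add: power_eq_if)
  qed
  ultimately show ?thesis using cong_sym cong_trans by blast
qed

lemma lucas_V_prime_period: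
  assumes "prime p" and "odd p"
  shows "[lucas_V P 1 (p + 1) = 2] (mod int p) \<or> [lucas_V P 1 (p - 1) = 2] (mod int p)"
proof -
  have p: "p > 0" using assms(1) prime_gt_0_nat by blast
  define a b c where "a = lucas_V P 1 (p + 1)" and "b = lucas_V P 1 (p - 1)" and "c = lucas_V P 1 p"
  have c: "[c = P] (mod int p)" unfolding c_def using assms by (rule lucas_V_prime)
  have sum: "a + b = c * P" using lucas_V_add_diff[of 1 p P] p by (simp add: a_def b_def c_def)
  have "lucas_V P 1 (2 * p) + lucas_V P 1 2 = a * b"
    using lucas_V_add_diff[of "p - 1" "p + 1" P] p by (simp add: a_def b_def mult_2)
  then have prod: "a * b = c\<^sup>2 - 2 + P\<^sup>2 - 2"
    using lucas_V_double[of P p] lucas_V_double[of P 1] by (simp add: c_def)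
  \<comment> \<open>The sum and product of \<open>a\<close> and \<open>b\<close> turn this into a
    square that vanishes modulo \<open>p\<close>, as \<open>c\<close> is congruent to
    \<open>P\<close>.\<close>
  have "(a - 2) * (b - 2) = (c - P)\<^sup>2"
    using sum prod by (simp add: power2_eq_square algebra_simps)
  also have "int p dvd \<dots>" using c by (simp add: cong_iff_dvd_diff power2_eq_square)
  finally have "int p dvd a - 2 \<or> int p dvd b - 2"
    using assms(1) by (simp add: prime_dvd_mult_iff)
  then show ?thesis by (simp add: cong_iff_dvd_diff a_def b_def)
qed

text \<open>If the exact power \<open>2 ^ t\<close> in \<open>e\<close> had
  \<open>t \<le> s\<close>, some odd multiple of \<open>k * 2 ^ s\<close> would be a multiple of
  \<open>e\<close>, and the value there would be both \<open>-2\<close> and \<open>2\<close> modulo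
  the odd \<open>p\<close>.\<close>

lemma two_power_dvd_lucas_V_period:
  fixes p :: nat
  assumes "odd p" and "p > 1"
    and neg: "[lucas_V P 1 (k * 2 ^ s) = - 2] (mod int p)"
    and per: "[lucas_V P 1 e = 2] (mod int p)"
  shows "2 ^ Suc s dvd e"
proof (rule ccontr)
  assume nd: "\<not> 2 ^ Suc s dvd e"
  then have "e \<noteq> 0" by (metis dvd_0_right)
  then obtain u where e: "e = 2 ^ multiplicity 2 e * u" and "odd u"
    using multiplicity_decompose'[of e 2] by auto
  define t where "t = multiplicity 2 e"
  note e = e[folded t_def]
  have ts: "t \<le> s"
  proof (rule ccontr)
    assume "\<not> t \<le> s"
    then have "2 ^ Suc s dvd (2::nat) ^ t" by (intro le_imp_power_dvd) simp
    then show False using nd e by simp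
  qed
  then have "k * 2 ^ s * u = e * (k * 2 ^ (s - t))"
    using power_add[of "2::nat" t "s - t"] e by simp
  then have "lucas_V (lucas_V P 1 (k * 2 ^ s)) 1 u = lucas_V (lucas_V P 1 e) 1 (k * 2 ^ (s - t))"
    by (simp only: lucas_V_mult[symmetric])
  moreover have "[lucas_V (lucas_V P 1 (k * 2 ^ s)) 1 u = - 2] (mod int p)"
    using lucas_V_cong[OF neg, of 1 u] \<open>odd u\<close> by (simp add: lucas_V_minus_2)
  moreover have "[lucas_V (lucas_V P 1 e) 1 (k * 2 ^ (s - t)) = 2] (mod int p)"
    using lucas_V_cong[OF per, of 1 "k * 2 ^ (s - t)"] by (simp add: lucas_V_2)
  ultimately have "[2 = - 2] (mod int p)" by (metis cong_sym cong_trans)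
  then have "int p dvd 2 * 2 * 1" by (simp add: cong_iff_dvd_diff)
  moreover have "coprime (int p) 2" using assms(1) by simp
  ultimately have "int p dvd 1" by (metis coprime_dvd_mult_right_iff mult.assoc)
  then show False using assms(2) by simp
qed

subsection \<open>The primality criterion\<close>

lemma prime_if_dvd_lucas_V:
  fixes m k N :: nat
  assumes m: "m > 2" and k: "odd k" "k < 2 ^ m" and N: "N = k * 2 ^ m + 1"
    and dvd: "int N dvd lucas_V P 1 (k * 2 ^ (m - 2))"
  shows "prime N"
proof (rule ccontr)
  assume np: "\<not> prime N"
  have "N > 1" using N k by (auto elim: oddE)
  then obtain a where a: "prime a" "a dvd N" using prime_factor_nat[of N] by auto
  then obtain b where "N = a * b" by (elim dvdE)
  moreover have "b \<noteq> 0" "b \<noteq> 1" using \<open>N = a * b\<close> \<open>N > 1\<close> np a(1) by auto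
  ultimately have ab: "N = a * b" "1 < a" "1 < b" using a(1) prime_gt_1_nat by auto
  \<comment> \<open>A prime factor of the smaller cofactor satisfies
    \<open>p * p \<le> N\<close>.\<close>
  obtain p where p: "prime p" "p dvd min a b"
    using ab(2,3) prime_factor_nat[of "min a b"] by (metis less_irrefl min_def)
  then have "p \<le> min a b" using ab(2,3) by (intro dvd_imp_le) auto
  then have "p * p \<le> N" unfolding ab(1) by (intro mult_mono) auto
  have "p dvd N" using p(2) unfolding ab(1) min_def by (auto split: if_splits)
  have "even (2 ^ m :: nat)" using m by simp
  then have "odd N" using N by simp
  then have "odd p" using \<open>p dvd N\<close> dvd_trans by blast
  have p1: "p > 1" using p(1) prime_gt_1_nat by blast
  obtain l where l: "m = Suc (Suc l)" using m by (cases m; cases "m - 1") auto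
  have "int p dvd lucas_V P 1 (k * 2 ^ (m - 2))"
    using \<open>p dvd N\<close> dvd by (meson dvd_trans int_dvd_int_iff)
  then have "[lucas_V P 1 (2 * (k * 2 ^ (m - 2))) = - 2] (mod int p)"
    by (simp add: lucas_V_double cong_iff_dvd_diff power2_eq_square)
  moreover have "2 * (k * 2 ^ (m - 2)) = k * 2 ^ (m - 1)"
    using l by simp
  ultimately have "[lucas_V P 1 (k * 2 ^ (m - 1)) = - 2] (mod int p)" by (simp only:)
  then have per: "2 ^ m dvd e" if "[lucas_V P 1 e = 2] (mod int p)" for e
    using two_power_dvd_lucas_V_period[OF \<open>odd p\<close> p1 _ that, of k "m - 1"] m by simp
  define M :: nat where "M = 2 ^ m"
  have "k * M \<le> (M - 1) * M" using k(2) by (intro mult_right_mono) (auto simp: M_def)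
  then have "N \<le> (M - 1) * M + 1" using N by (simp add: M_def)
  then have pM: "p * p \<le> (M - 1) * M + 1" using \<open>p * p \<le> N\<close> by simp
  have M: "M \<ge> 2" using m self_le_power[of 2 m] by (auto simp: M_def)
  have "p < M + 1"
  proof (rule ccontr)
    assume "\<not> p < M + 1"
    then have "(M + 1) * (M + 1) \<le> p * p" by (intro mult_mono) auto
    then show False using pM M by (simp add: algebra_simps)
  qed
  have "M dvd p + 1 \<or> M dvd p - 1"
    using lucas_V_prime_period[OF p(1) \<open>odd p\<close>] per unfolding M_def by blast
  then have "p + 1 = M"
  proof
    assume "M dvd p + 1"
    then obtain c where c: "p + 1 = M * c" by (elim dvdE)
    have "c < 2"
    proof (rule ccontr)
      assume "\<not> c < 2"
      then have "M * 2 \<le> M * c" by (intro mult_left_mono) auto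
      then show False using c \<open>p < M + 1\<close> M p1 by linarith
    qed
    then show "p + 1 = M" using c by (cases c) auto
  next
    assume "M dvd p - 1"
    then have "M \<le> p - 1" using p1 by (intro dvd_imp_le) auto
    then show "p + 1 = M" using \<open>p < M + 1\<close> p1 by simp
  qed
  \<comment> \<open>Now \<open>N = k * p + (k + 1)\<close> and
    \<open>k + 1 \<le> p + 1 < 2 * p\<close>, so divisibility by \<open>p\<close> leaves only
    \<open>k + 1 = p\<close>, against parity.\<close>
  have "k + 1 < M + 1" using k(2) by (simp add: M_def)
  have "k * M + 1 = k * p + (k + 1)" using \<open>p + 1 = M\<close> by (auto simp: algebra_simps)
  then have "p dvd k + 1" using \<open>p dvd N\<close> N by (metis M_def dvd_add_right_iff dvd_triv_right)
  then obtain c where c: "k + 1 = p * c" by (elim dvdE)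
  have "c < 2"
  proof (rule ccontr)
    assume "\<not> c < 2"
    then have "p * 2 \<le> p * c" by (intro mult_left_mono) auto
    then show False using c \<open>k + 1 < M + 1\<close> \<open>p + 1 = M\<close> p1 by linarith
  qed
  then have "k + 1 = p" using c by (cases c) auto
  then show False using k(1) \<open>odd p\<close> by (metis even_plus_one_iff)
qed

section \<open>Quadratic characters and the case of prime \<open>N\<close>\<close>

lemma Legendre_reciprocity_1_mod_4:
  assumes "prime p" "prime q" "p > 2" "q > 2" "p \<noteq> q" "[q = 1] (mod 4)"
  shows "Legendre (int p) (int q) * Legendre (int q) (int p) = 1"
proof -
  have "even ((q - 1) div 2)" using assms(4,6) by (auto simp: cong_def) presburger
  then show ?thesis using Quadratic_Reciprocity[of p q] assms by simp
qed

text \<open>Modulo \<open>N\<close>, \<open>6 * A\<close> is a square and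
  \<open>12 ^ (2 * n)\<close> is \<open>-1\<close>, so \<open>A ^ (2 * n) + 4 ^ n\<close> vanishes.
  As \<open>A * B\<close> is \<open>4\<close>, this is \<open>A ^ n * (A ^ n + B ^ n)\<close>, where
  \<open>A ^ n\<close> cancels.\<close>

lemma dvd_lucas_V_5_if_prime:
  fixes N n :: nat
  assumes N: "prime N" "N = 4 * n + 1" "N > 3"
    and leg: "Legendre 3 (int N) = - 1" "Legendre 7 (int N) = - 1"
  shows "int N dvd lucas_V 5 1 n"
proof -
  let ?N = "int N"
  have half: "(N - 1) div 2 = 2 * n" using N(2) by simp
  have euler: "[Legendre a ?N = a ^ (2 * n)] (mod ?N)" for a
    using euler_criterion[of N a] N(1,3) half by simp
  have e3: "[3 ^ (2 * n) = - 1] (mod ?N)" and e7: "[7 ^ (2 * n) = - 1] (mod ?N)"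
    using euler[of 3] euler[of 7] leg by (auto intro: cong_sym)
  have "[3 ^ (2 * n) * 7 ^ (2 * n) = - 1 * - 1] (mod ?N)" using e3 e7 by (rule cong_mult)
  then have "[21 ^ (2 * n) = 1] (mod ?N)" by (simp flip: power_mult_distrib)
  then have l21: "[Legendre 21 ?N = 1] (mod ?N)" using euler cong_trans by blast
  have "QuadRes ?N 21"
  proof (rule ccontr)
    \<comment> \<open>A Legendre value \<open>0\<close> or \<open>-1\<close> congruent to
      \<open>1\<close> would make \<open>N\<close> divide \<open>1\<close> or
      \<open>2\<close>.\<close>
    assume "\<not> QuadRes ?N 21"
    then have "?N dvd 1 \<or> ?N dvd 2"
      using l21 by (auto simp: Legendre_def cong_iff_dvd_diff split: if_splits)
    then show False using N(3) zdvd_imp_le[of ?N 1] zdvd_imp_le[of ?N 2] by auto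
  qed
  then obtain s where s: "[s\<^sup>2 = 21] (mod ?N)" unfolding QuadRes_def by blast
  \<comment> \<open>Modulo \<open>N\<close> these are twice the roots of
    \<open>X\<^sup>2 - 5 * X + 1\<close>; the factor \<open>2\<close> avoids division.\<close>
  define A B where "A = 5 + s" and "B = 5 - s"
  have AB: "[A * B = 4] (mod ?N)"
  proof -
    have "A * B - 4 = - (s\<^sup>2 - 21)" by (simp add: A_def B_def power2_eq_square algebra_simps)
    then show ?thesis using s by (simp add: cong_iff_dvd_diff) (metis dvd_minus_iff minus_diff_eq)
  qed
  have V: "[2 ^ j * lucas_V 5 1 j = A ^ j + B ^ j] (mod ?N)" for j
  proof (induction j rule: induct_nat_012)
    case (ge2 j)
    have "2 ^ Suc (Suc j) * lucas_V 5 1 (Suc (Suc j))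
        = 10 * (2 ^ Suc j * lucas_V 5 1 (Suc j)) - 4 * (2 ^ j * lucas_V 5 1 j)"
      by (simp add: algebra_simps)
    moreover have "[10 * (2 ^ Suc j * lucas_V 5 1 (Suc j)) - 4 * (2 ^ j * lucas_V 5 1 j)
        = 10 * (A ^ Suc j + B ^ Suc j) - (A * B) * (A ^ j + B ^ j)] (mod ?N)"
      using ge2 AB by (intro cong_diff cong_mult) (auto intro: cong_sym)
    moreover have "10 * (A ^ Suc j + B ^ Suc j) - (A * B) * (A ^ j + B ^ j) = A ^ Suc (Suc j) + B ^ Suc (Suc j)"
      by (simp add: A_def B_def algebra_simps)
    ultimately show ?case by (simp only:)
  qed (simp_all add: A_def B_def)
  have A6: "[6 * A = (3 + s)\<^sup>2] (mod ?N)"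
  proof -
    have "6 * A - (3 + s)\<^sup>2 = - (s\<^sup>2 - 21)" by (simp add: A_def power2_eq_square algebra_simps)
    then show ?thesis using s by (simp add: cong_iff_dvd_diff) (metis dvd_minus_iff minus_diff_eq)
  qed
  have pN: "prime ?N" using N(1) by simp
  have n3: "\<not> ?N dvd 3" using zdvd_imp_le[of ?N 3] N(3) by auto
  have n2: "\<not> ?N dvd 2" using zdvd_imp_le[of ?N 2] N(3) by auto
  have n12: "\<not> ?N dvd 2 * 2 * 3"
    using n2 n3 pN by (simp only: prime_dvd_mult_iff) simp
  \<comment> \<open>The product \<open>(3 + s) * (s - 3)\<close> is \<open>s\<^sup>2 - 9\<close>,
    hence \<open>12\<close> modulo \<open>N\<close>.\<close>
  have s3: "\<not> ?N dvd 3 + s"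
  proof
    assume "?N dvd 3 + s"
    then have "?N dvd (3 + s) * (s - 3) - (s\<^sup>2 - 21)"
      using s unfolding cong_iff_dvd_diff by (rule dvd_diff[OF dvd_mult2])
    also have "(3 + s) * (s - 3) - (s\<^sup>2 - 21) = 2 * 2 * 3"
      by (simp add: power2_eq_square algebra_simps)
    finally show False using n12 by simp
  qed
  have Nm1: "N - 1 = 2 * (2 * n)" using N(2) by simp
  have "[(6 * A) ^ (2 * n) = ((3 + s)\<^sup>2) ^ (2 * n)] (mod ?N)" using A6 by (rule cong_pow)
  moreover have "[((3 + s)\<^sup>2) ^ (2 * n) = 1] (mod ?N)"
    using fermat_int[OF N(1) s3] unfolding Nm1 power_mult .
  ultimately have A6n: "[(6 * A) ^ (2 * n) = 1] (mod ?N)" by (rule cong_trans)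
  have "[3 ^ (2 * n) * 2 ^ (N - 1) = - 1 * 1] (mod ?N)"
    using e3 fermat_int[OF N(1) n2] by (rule cong_mult)
  also have "3 ^ (2 * n) * 2 ^ (N - 1) = (12 :: int) ^ (2 * n)"
    unfolding Nm1 power_mult[of 2 2 "2 * n"] by (simp flip: power_mult_distrib)
  finally have "[(6 * A) ^ (2 * n) + 12 ^ (2 * n) = 1 + - 1 * 1] (mod ?N)"
    by (intro cong_add A6n)
  moreover have "(6 * A) ^ (2 * n) + 12 ^ (2 * n) = 6 ^ (2 * n) * (A ^ (2 * n) + 4 ^ n)"
  proof -
    have "(4::int) ^ n = 2 ^ (2 * n)" by (simp add: power_mult)
    moreover have "(12::int) ^ (2 * n) = 6 ^ (2 * n) * 2 ^ (2 * n)" by (simp flip: power_mult_distrib)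
    ultimately show ?thesis by (simp only: power_mult_distrib distrib_left)
  qed
  ultimately have "?N dvd 6 ^ (2 * n) * (A ^ (2 * n) + 4 ^ n)" by (simp add: cong_0_iff)
  moreover have "\<not> ?N dvd 6 ^ (2 * n)"
  proof
    assume "?N dvd 6 ^ (2 * n)"
    then have "?N dvd 2 * 3" using prime_dvd_power[OF pN] by force
    then show False using n2 n3 pN by (simp only: prime_dvd_mult_iff) simp
  qed
  ultimately have A4: "?N dvd A ^ (2 * n) + 4 ^ n" using pN prime_dvd_mult_iff by blast
  have "[A ^ n * (2 ^ n * lucas_V 5 1 n) = A ^ n * (A ^ n + B ^ n)] (mod ?N)"
    by (intro cong_scalar_left V)
  also have "A ^ n * (A ^ n + B ^ n) = A ^ (2 * n) + (A * B) ^ n"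
    by (simp add: distrib_left power_mult_distrib mult_2 power_add)
  also have "[\<dots> = A ^ (2 * n) + 4 ^ n] (mod ?N)"
    using AB by (intro cong_add cong_pow) auto
  finally have "?N dvd A ^ n * (2 ^ n * lucas_V 5 1 n)"
    using A4 by (metis cong_0_iff cong_trans)
  moreover have "\<not> ?N dvd A ^ n"
  proof
    assume "?N dvd A ^ n"
    then have "?N dvd A" using prime_dvd_power[OF pN] by blast
    then have "?N dvd (3 + s)\<^sup>2" using A6 by (metis cong_0_iff cong_sym cong_trans dvd_mult)
    then show False using s3 pN prime_dvd_power by blast
  qed
  moreover have "\<not> ?N dvd 2 ^ n" using n2 pN prime_dvd_power by blast
  ultimately show ?thesis using pN by (simp add: prime_dvd_mult_iff)
qed

text \<open>As \<open>N\<close> is \<open>1\<close> modulo \<open>4\<close>, reciprocity carries no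
  sign, so it suffices that \<open>N\<close> is no square modulo \<open>3\<close> or
  \<open>7\<close>: the squares are \<open>0, 1\<close> and \<open>0, 1, 2, 4\<close>
  respectively.\<close>

lemma Legendre_3_7_nonresidues:
  assumes "prime N" "N > 7" "[N = 1] (mod 4)" "[N = 2] (mod 3)" "N mod 7 \<in> {3, 5, 6}"
  shows "Legendre 3 (int N) = - 1" "Legendre 7 (int N) = - 1"
proof -
  have sq3: "y\<^sup>2 mod 3 \<noteq> 2" for y :: int
  proof -
    have "y mod 3 \<in> {0, 1, 2}" by auto
    then show ?thesis by (subst power_mod[symmetric]) auto
  qed
  have sq7: "y\<^sup>2 mod 7 \<notin> {3, 5, 6}" for y :: int
  proof -
    have "y mod 7 \<in> {0, 1, 2, 3, 4, 5, 6}" by auto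
    then show ?thesis by (subst power_mod[symmetric]) auto
  qed
  have m3: "int N mod 3 = 2" using assms(4) by (simp add: cong_def) presburger
  then have "\<not> QuadRes 3 (int N)"
    using sq3 m3 unfolding QuadRes_def cong_def by metis
  then have "Legendre (int N) 3 = - 1"
    using m3 by (auto simp: Legendre_def cong_def)
  then show "Legendre 3 (int N) = - 1"
    using Legendre_reciprocity_1_mod_4[of 3 N] assms by simp
  have m7: "int N mod 7 \<in> {3, 5, 6}"
    using assms(5) zmod_int[of N 7] by auto
  then have "\<not> QuadRes 7 (int N)"
    using sq7 m7 unfolding QuadRes_def cong_def by metis
  then have "Legendre (int N) 7 = - 1"
    using m7 by (auto simp: Legendre_def cong_def)
  then show "Legendre 7 (int N) = - 1"
    using Legendre_reciprocity_1_mod_4[of 7 N] assms by simp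
qed

theorem theorem3p3:
  fixes m k N :: nat and x :: int
  assumes "m > 2"
    and "0 < k" and "k < 2 ^ m"
    and "N = k * 2 ^ m + 1"
    and "[k = 1] (mod 42) \<and> ([m = 2] (mod 6) \<or> [m = 4] (mod 6)) \<or>
         [k = 5] (mod 42) \<and> [m = 3] (mod 6) \<or>
         [k = 11] (mod 42) \<and> ([m = 3] (mod 6) \<or> [m = 5] (mod 6)) \<or>
         [k = 13] (mod 42) \<and> [m = 4] (mod 6) \<or>
         [k = 17] (mod 42) \<and> [m = 5] (mod 6) \<or>
         [k = 19] (mod 42) \<and> [m = 0] (mod 6) \<or>
         [k = 23] (mod 42) \<and> ([m = 1] (mod 6) \<or> [m = 3] (mod 6)) \<or>
         [k = 25] (mod 42) \<and> ([m = 0] (mod 6) \<or> [m = 2] (mod 6)) \<or>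
         [k = 29] (mod 42) \<and> ([m = 1] (mod 6) \<or> [m = 5] (mod 6)) \<or>
         [k = 31] (mod 42) \<and> [m = 2] (mod 6) \<or>
         [k = 37] (mod 42) \<and> ([m = 0] (mod 6) \<or> [m = 4] (mod 6)) \<or>
         [k = 41] (mod 42) \<and> [m = 1] (mod 6)"
    and "x = lucas_V 5 1 k"
  shows "prime N \<longleftrightarrow> int N dvd S (m - 2) x"
proof -
  note cond = assms(5)
  \<comment> \<open>All listed residues of \<open>k\<close> are odd, and \<open>42\<close> is
    even.\<close>
  have "odd (k mod 42)" using cond by (elim disjE conjE) (simp_all add: cong_def)
  then have "odd k" by (simp add: dvd_mod_iff)
  have m: "m = Suc (Suc (m - 2))" using assms(1) by simp
  define n where "n = k * 2 ^ (m - 2)"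
  have n: "N = 4 * n + 1"
    unfolding assms(4) n_def by (subst m) simp
  have S: "S (m - 2) x = lucas_V 5 1 n"
    by (simp add: assms(6) S_lucas_V n_def)
  \<comment> \<open>Since \<open>2 ^ 6 = 64\<close> is \<open>1\<close> modulo \<open>21\<close>,
    the residue of \<open>N\<close> modulo \<open>21\<close> depends only on \<open>k mod 42\<close>
    and \<open>m mod 6\<close>.\<close>
  have "(2::nat) ^ m = (2 ^ 6) ^ (m div 6) * 2 ^ (m mod 6)"
    by (simp only: flip: power_mult power_add) simp
  also have "[\<dots> = 1 ^ (m div 6) * 2 ^ (m mod 6)] (mod 21)"
    by (intro cong_mult cong_pow) (simp_all add: cong_def)
  finally have "[N = k * 2 ^ (m mod 6) + 1] (mod 21)"
    unfolding assms(4) by (intro cong_add cong_mult) simp_all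
  moreover have "[k = k mod 42] (mod 21)" by (simp add: cong_def mod_mod_cancel)
  then have "[k * 2 ^ (m mod 6) + 1 = k mod 42 * 2 ^ (m mod 6) + 1] (mod 21)"
    by (intro cong_add cong_mult) simp_all
  ultimately have "[N = k mod 42 * 2 ^ (m mod 6) + 1] (mod 21)" by (rule cong_trans)
  \<comment> \<open>These are exactly the classes that are \<open>2\<close> modulo \<open>3\<close>
    and \<open>3\<close>, \<open>5\<close> or \<open>6\<close> modulo \<open>7\<close>.\<close>
  then have N21: "N mod 21 \<in> {5, 17, 20}"
    using cond by (elim disjE conjE) (simp_all add: cong_def)
  have "[N = 2] (mod 3)" "N mod 7 \<in> {3, 5, 6}"
    using N21 mod_mod_cancel[of 3 21 N] mod_mod_cancel[of 7 21 N] by (auto simp: cong_def)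
  moreover have "N > 7"
  proof -
    have "2 ^ 3 \<le> (2::nat) ^ m" using assms(1) by (intro power_increasing) auto
    also have "\<dots> \<le> k * 2 ^ m" using assms(2) by simp
    finally show ?thesis using assms(4) by simp
  qed
  moreover have "[N = 1] (mod 4)" by (simp add: n cong_def)
  ultimately have "int N dvd S (m - 2) x" if "prime N"
    using dvd_lucas_V_5_if_prime[OF that n] Legendre_3_7_nonresidues[OF that] by (simp add: S)
  moreover have "prime N" if "int N dvd S (m - 2) x"
    using prime_if_dvd_lucas_V[OF assms(1) \<open>odd k\<close> assms(3,4), of 5] that by (simp add: S n_def)
  ultimately show ?thesis by blast
qed

end
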